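(* Let $p\ge 1$ and let $q=p$ or $q=p-1$. Let $(\mathbf{c},\mathbf{A},\mathbf{U},\mathbf{B},\mathbf{V})$ be a diagonally implicit general linear method (the underlying GLM) that has order $p$ and stage order $q$, and let the extrapolation procedure with coefficient matrices $\alpha,\beta\in\mathbb{R}^{s\times s}$ ($\beta$ strictly lower triangular) have order $p$. Then the extrapolation-based IMEX GLM $$Y^{[n+1]}=h(\mathbf{A}\alpha\otimes \mathbf{I})f(Y^{[n]})+h(\mathbf{A}\beta\otimes \mathbf{I})f(Y^{[n+1]})+h(\mathbf{A}\otimes \mathbf{I})g(Y^{[n+1]})+(\mathbf{U}\otimes \mathbf{I})y^{[n]},$$ $$y^{[n+1]}=h(\mathbf{B}\alpha\otimes \mathbf{I})f(Y^{[n]})+h(\mathbf{B}\beta\otimes \mathbf{I})f(Y^{[n+1]})+h(\mathbf{B}\otimes \mathbf{I})g(Y^{[n+1]})+(\mathbf{V}\otimes \mathbf{I})y^{[n]}$$ for the system $y'=f(y)+g(y)$ has order $p$ and stage order $q$.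
   Context: Conventions: powers of vectors are componentwise, with $\mathbf{x}^0=\mathbf{e}=[1,\dots,1]^T$ (so $0^0=1$); a term $k\,\mathbf{M}\mathbf{c}^{k-1}$ is $0$ for $k=0$. The identity $\mathbf{I}$ in Kronecker products has the dimension $m$ of the ODE system; $f,g$ are applied blockwise to stage vectors; $t_n=t_0+nh$. GLM: A diagonally implicit general linear method with $s$ stages and $r$ external approximations is given by an abscissa vector $\mathbf{c}=[c_1,\dots,c_s]^T\in\mathbb{R}^s$, a lower triangular matrix $\mathbf{A}\in\mathbb{R}^{s\times s}$, and matrices $\mathbf{U}\in\mathbb{R}^{s\times r}$, $\mathbf{B}\in\mathbb{R}^{r\times s}$, $\mathbf{V}\in\mathbb{R}^{r\times r}$. For $y'=F(y)$ with $F=f+g$ it reads $Y^{[n+1]}=h(\mathbf{A}\otimes\mathbf{I})F(Y^{[n+1]})+(\mathbf{U}\otimes\mathbf{I})y^{[n]}$, $y^{[n+1]}=h(\mathbf{B}\otimes\mathbf{I})F(Y^{[n+1]})+(\mathbf{V}\otimes\mathbf{I})y^{[n]}$, where $Y_i^{[n+1]}$ approximates $y(t_n+c_ih)$ with error $O(h^{q+1})$ and $y_i^{[n]}$ approximates $\sum_{k=0}^p q_{ik}h^ky^{(k)}(t_n)$ with error $O(h^{p+1})$. Order of a GLM: for $q\in\{p-1,p\}$, the GLM has order $p$ and stage order $q$ if and only if there are vectors $\mathbf{q}_0,\dots,\mathbf{q}_p\in\mathbb{R}^r$ with $$\mathbf{c}^k-k\,\mathbf{A}\mathbf{c}^{k-1}-k!\,\mathbf{U}\mathbf{q}_k=0,\quad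 k=0,\dots,q,$$ $$\sum_{\ell=0}^k\frac{k!}{\ell!}\mathbf{q}_{k-\ell}-k\,\mathbf{B}\mathbf{c}^{k-1}-k!\,\mathbf{V}\mathbf{q}_k=0,\quad k=0,\dots,p.$$ (This is a known characterization and may be taken as the definition.) Extrapolation procedure: $f(Y_j^{[n+1]})$ is replaced by $f_j^{[n+1]}=\sum_{k=1}^s\alpha_{jk}f(Y_k^{[n]})+\sum_{k=1}^{j-1}\beta_{jk}f(Y_k^{[n+1]})$, $j=1,\dots,s$. It has order $p$ if $\alpha(\mathbf{c}-\mathbf{e})^\ell+\beta\,\mathbf{c}^\ell=\mathbf{c}^\ell$ for $\ell=0,1,\dots,p-1$. Order of the IMEX GLM: the IMEX GLM has order $p$ and stage order $q$ if there are vectors $\mathbf{q}_0,\dots,\mathbf{q}_p\in\mathbb{R}^r$, $\mathbf{q}_k=[q_{1k},\dots,q_{rk}]^T$, such that for all smooth $f,g:\mathbb{R}^m\to\mathbb{R}^m$ and every solution $y$ of $y'=f(y)+g(y)$ the following holds. If, as $h\to0$, $Y_i^{[n]}=y(t_n+(c_i-1)h)+O(h^{q+1})$ for $i=1,\dots,s$ and $y_i^{[n]}=\sum_{k=0}^pq_{ik}h^ky^{(k)}(t_n)+O(h^{p+1})$ for $i=1,\dots,r$, then one step of the method (taking the solution $Y^{[n+1]}$ of the stage equations that remains bounded as $h\to0$) gives $Y_i^{[n+1]}=y(t_n+c_ih)+O(h^{q+1})$ for $i=1,\dots,s$ and $y_i^{[n+1]}=\sum_{k=0}^pq_{ik}h^ky^{(k)}(t_{n+1})+O(h^{p+1})$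 for $i=1,\dots,r$. *)

theory Defs
  imports "HOL-Analysis.Analysis" "HOL-Library.Landau_Symbols"
begin

text \<open>The library makes \<open>real ^ 'n\<close> a ring under componentwise multiplication, so \<open>c ^ k\<close> is
  the componentwise power and \<open>1\<close> is the all-ones vector. The dimensions \<open>s\<close>, \<open>r\<close> (stages, external
  approximations) and \<open>m\<close> (size of the ODE system) are the index types \<open>'s\<close>, \<open>'r\<close>, \<open>'m\<close>.\<close>

definition lower_triangular :: "real ^ 's :: {finite, linorder} ^ 's :: {finite, linorder} \<Rightarrow> bool" where
  "lower_triangular M \<longleftrightarrow> (\<forall>i j. i < j \<longrightarrow> M $ i $ j = 0)"

definition strictly_lower_triangular :: "real ^ 's :: {finite, linorder} ^ 's :: {finite, linorder} \<Rightarrow> bool" where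
  "strictly_lower_triangular M \<longleftrightarrow> (\<forall>i j. i \<le> j \<longrightarrow> M $ i $ j = 0)"

definition glm_order ::
  "nat \<Rightarrow> nat \<Rightarrow> real ^ 's \<Rightarrow> real ^ 's ^ 's \<Rightarrow> real ^ 'r ^ 's \<Rightarrow> real ^ 's ^ 'r \<Rightarrow> real ^ 'r ^ 'r \<Rightarrow> bool"
where
  "glm_order p q c A U B V \<longleftrightarrow>
    (\<exists>Q :: nat \<Rightarrow> real ^ 'r.
      (\<forall>k\<le>q. c ^ k - real k *\<^sub>R (A *v c ^ (k - 1)) - fact k *\<^sub>R (U *v Q k) = 0) \<and>
      (\<forall>k\<le>p. (\<Sum>l\<le>k. (fact k / fact l) *\<^sub>R Q (k - l)) - real k *\<^sub>R (B *v c ^ (k - 1))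
               - fact k *\<^sub>R (V *v Q k) = 0))"

definition extrapolation_order ::
  "nat \<Rightarrow> real ^ 's \<Rightarrow> real ^ 's ^ 's \<Rightarrow> real ^ 's ^ 's \<Rightarrow> bool"
where
  "extrapolation_order p c \<alpha> \<beta> \<longleftrightarrow> (\<forall>l<p. \<alpha> *v (c - 1) ^ l + \<beta> *v c ^ l = c ^ l)"

text \<open>A stacked vector of \<open>n\<close> blocks of size \<open>m\<close> has type \<open>(real ^ 'm) ^ 'n\<close>. On such vectors
  \<open>kron_I M\<close> is multiplication by the Kronecker product of \<open>M\<close> with the \<open>m\<close>-dimensional identity
  matrix, and \<open>blockwise f\<close> applies \<open>f\<close> to each block.\<close>

definition kron_I :: "real ^ 'a ^ 'b \<Rightarrow> (real ^ 'm) ^ 'a \<Rightarrow> (real ^ 'm) ^ 'b" where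
  "kron_I M Y = (\<chi> i. \<Sum>j\<in>UNIV. M $ i $ j *\<^sub>R Y $ j)"

definition blockwise :: "(real ^ 'm \<Rightarrow> real ^ 'm) \<Rightarrow> (real ^ 'm) ^ 'n \<Rightarrow> (real ^ 'm) ^ 'n" where
  "blockwise f Y = (\<chi> i. f (Y $ i))"

definition imex_stages ::
  "real ^ 's ^ 's \<Rightarrow> real ^ 'r ^ 's \<Rightarrow> real ^ 's ^ 's \<Rightarrow> real ^ 's ^ 's \<Rightarrow>
   (real ^ 'm \<Rightarrow> real ^ 'm) \<Rightarrow> (real ^ 'm \<Rightarrow> real ^ 'm) \<Rightarrow> real \<Rightarrow>
   (real ^ 'm) ^ 's \<Rightarrow> (real ^ 'm) ^ 'r \<Rightarrow> (real ^ 'm) ^ 's \<Rightarrow> bool"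
where
  "imex_stages A U \<alpha> \<beta> f g h Yold yold Ynew \<longleftrightarrow>
     Ynew = h *\<^sub>R kron_I (A ** \<alpha>) (blockwise f Yold) + h *\<^sub>R kron_I (A ** \<beta>) (blockwise f Ynew)
          + h *\<^sub>R kron_I A (blockwise g Ynew) + kron_I U yold"

definition imex_output ::
  "real ^ 's ^ 'r \<Rightarrow> real ^ 'r ^ 'r \<Rightarrow> real ^ 's ^ 's \<Rightarrow> real ^ 's ^ 's \<Rightarrow>
   (real ^ 'm \<Rightarrow> real ^ 'm) \<Rightarrow> (real ^ 'm \<Rightarrow> real ^ 'm) \<Rightarrow> real \<Rightarrow>
   (real ^ 'm) ^ 's \<Rightarrow> (real ^ 'm) ^ 'r \<Rightarrow> (real ^ 'm) ^ 's \<Rightarrow> (real ^ 'm) ^ 'r"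
where
  "imex_output B V \<alpha> \<beta> f g h Yold yold Ynew =
     h *\<^sub>R kron_I (B ** \<alpha>) (blockwise f Yold) + h *\<^sub>R kron_I (B ** \<beta>) (blockwise f Ynew)
     + h *\<^sub>R kron_I B (blockwise g Ynew) + kron_I V yold"

text \<open>\<open>Ck k f\<close>: \<open>f\<close> is \<open>k\<close> times continuously differentiable on the whole space. In finite dimension,
  continuity of the derivative is the same as continuity of all directional derivatives.\<close>

fun Ck :: "nat \<Rightarrow> ('a::euclidean_space \<Rightarrow> 'b::euclidean_space) \<Rightarrow> bool" where
  "Ck 0 f \<longleftrightarrow> continuous_on UNIV f"
| "Ck (Suc k) f \<longleftrightarrow> (\<forall>x. f differentiable (at x)) \<and> (\<forall>v. Ck k (\<lambda>x. frechet_derivative f (at x) v))"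

definition smooth :: "('a::euclidean_space \<Rightarrow> 'b::euclidean_space) \<Rightarrow> bool" where
  "smooth f \<longleftrightarrow> (\<forall>k. Ck k f)"

definition nth_derivative :: "nat \<Rightarrow> (real \<Rightarrow> 'a::real_normed_vector) \<Rightarrow> real \<Rightarrow> 'a" where
  "nth_derivative k y = ((\<lambda>u t. vector_derivative u (at t)) ^^ k) y"

definition ode_solution_on :: "real set \<Rightarrow> (real ^ 'm \<Rightarrow> real ^ 'm) \<Rightarrow> (real \<Rightarrow> real ^ 'm) \<Rightarrow> bool" where
  "ode_solution_on J F y \<longleftrightarrow> (\<forall>t\<in>J. (y has_vector_derivative F (y t)) (at t))"

text \<open>\<open>approx_order k u v\<close>: \<open>u h = v h + O(h ^ k)\<close> as the step size \<open>h > 0\<close> tends to \<open>0\<close>.\<close>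

definition approx_order :: "nat \<Rightarrow> (real \<Rightarrow> 'a::real_normed_vector) \<Rightarrow> (real \<Rightarrow> 'a) \<Rightarrow> bool" where
  "approx_order k u v \<longleftrightarrow> (\<lambda>h. norm (u h - v h)) \<in> O[at_right 0](\<lambda>h. h ^ k)"

definition external_exact ::
  "nat \<Rightarrow> (nat \<Rightarrow> real ^ 'r) \<Rightarrow> (real \<Rightarrow> real ^ 'm) \<Rightarrow> real \<Rightarrow> real \<Rightarrow> 'r \<Rightarrow> real ^ 'm"
where
  "external_exact p Q y h t i = (\<Sum>k\<le>p. (Q k $ i * h ^ k) *\<^sub>R nth_derivative k y t)"

text \<open>A family \<open>h \<mapsto> Ynew h\<close> of stage vectors that solves the stage equations for all sufficiently
  small step sizes and remains bounded as \<open>h\<close> tends to \<open>0\<close>.\<close>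

definition bounded_stage_solution ::
  "real ^ 's ^ 's \<Rightarrow> real ^ 'r ^ 's \<Rightarrow> real ^ 's ^ 's \<Rightarrow> real ^ 's ^ 's \<Rightarrow>
   (real ^ 'm \<Rightarrow> real ^ 'm) \<Rightarrow> (real ^ 'm \<Rightarrow> real ^ 'm) \<Rightarrow>
   (real \<Rightarrow> (real ^ 'm) ^ 's) \<Rightarrow> (real \<Rightarrow> (real ^ 'm) ^ 'r) \<Rightarrow> (real \<Rightarrow> (real ^ 'm) ^ 's) \<Rightarrow> bool"
where
  "bounded_stage_solution A U \<alpha> \<beta> f g Yold yold Ynew \<longleftrightarrow>
     (\<forall>\<^sub>F h in at_right 0. imex_stages A U \<alpha> \<beta> f g h (Yold h) (yold h) (Ynew h)) \<and>
     (\<exists>K. \<forall>\<^sub>F h in at_right 0. norm (Ynew h) \<le> K)"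

text \<open>Order of the IMEX method for systems of dimension \<open>CARD('m)\<close>. Here \<open>n\<close> and \<open>t0\<close> are fixed and
  \<open>t\<^sub>n = t0 + n * h\<close>; in particular \<open>n = 0\<close> covers a step from an arbitrary fixed point in time. The
  input and output quantities are functions of \<open>h\<close>. ``The'' bounded solution of the stage equations
  is rendered by existence together with the error bounds for every bounded solution.\<close>

definition imex_glm_order ::
  "'m::finite itself \<Rightarrow> nat \<Rightarrow> nat \<Rightarrow> real ^ 's \<Rightarrow> real ^ 's ^ 's \<Rightarrow> real ^ 'r ^ 's \<Rightarrow> real ^ 's ^ 'r \<Rightarrow>
   real ^ 'r ^ 'r \<Rightarrow> real ^ 's ^ 's \<Rightarrow> real ^ 's ^ 's \<Rightarrow> bool"
where
  "imex_glm_order _ p q c A U B V \<alpha> \<beta> \<longleftrightarrow>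
    (\<exists>Q :: nat \<Rightarrow> real ^ 'r.
      \<forall>(f :: real ^ 'm \<Rightarrow> real ^ 'm) (g :: real ^ 'm \<Rightarrow> real ^ 'm) (J :: real set)
        (y :: real \<Rightarrow> real ^ 'm) (t0 :: real) (n :: nat)
        (Yold :: real \<Rightarrow> (real ^ 'm) ^ 's) (yold :: real \<Rightarrow> (real ^ 'm) ^ 'r).
        smooth f \<and> smooth g \<and>
        open J \<and> is_interval J \<and> t0 \<in> J \<and> ode_solution_on J (\<lambda>x. f x + g x) y \<and>
        (\<forall>i. approx_order (q + 1) (\<lambda>h. Yold h $ i) (\<lambda>h. y (t0 + real n * h + (c $ i - 1) * h))) \<and>
        (\<forall>i. approx_order (p + 1) (\<lambda>h. yold h $ i)
               (\<lambda>h. external_exact p Q y h (t0 + real n * h) i))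
      \<longrightarrow>
        (\<exists>Ynew. bounded_stage_solution A U \<alpha> \<beta> f g Yold yold Ynew) \<and>
        (\<forall>Ynew. bounded_stage_solution A U \<alpha> \<beta> f g Yold yold Ynew \<longrightarrow>
          (\<forall>i. approx_order (q + 1) (\<lambda>h. Ynew h $ i) (\<lambda>h. y (t0 + real n * h + c $ i * h))) \<and>
          (\<forall>i. approx_order (p + 1)
                 (\<lambda>h. imex_output B V \<alpha> \<beta> f g h (Yold h) (yold h) (Ynew h) $ i)
                 (\<lambda>h. external_exact p Q y h (t0 + real (n + 1) * h) i))))"

end

theory Submission
  imports Defs
begin

text \<open>The exact stage values \<open>y (t\<^sub>n + c\<^sub>i h)\<close> satisfy the right-hand side of the IMEX step up to
  the required order: Taylor expansion turns the extrapolation condition into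
  \<open>\<alpha> f(Y\<^sub>o\<^sub>l\<^sub>d) + \<beta> f(Y) = f(Y) + O(h\<^sup>p)\<close>, and the factor \<open>h\<close> in front absorbs the lost power, so that the
  order conditions of the underlying method apply with \<open>F = f + g\<close>. The computed stages are only known
  to be bounded, i.e. correct to order \<open>0\<close>; inserting them repeatedly into the stage equations gains
  one order each time until \<open>q + 1\<close> is reached.\<close>

section \<open>Calculus of error orders as the step size tends to zero\<close>

lemma approx_order_iff:
  "approx_order k u v \<longleftrightarrow> (\<exists>C. \<forall>\<^sub>F h in at_right 0. norm (u h - v h) \<le> C * h ^ k)"
proof
  assume "approx_order k u v"
  then obtain C where "\<forall>\<^sub>F h in at_right 0. norm (norm (u h - v h)) \<le> C * norm (h ^ k)"
    unfolding approx_order_def by (auto elim: landau_o.bigE)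
  then have "\<forall>\<^sub>F h in at_right 0. norm (u h - v h) \<le> C * h ^ k"
    using eventually_at_right_less[of 0] by eventually_elim (simp add: power_abs)
  then show "\<exists>C. \<forall>\<^sub>F h in at_right 0. norm (u h - v h) \<le> C * h ^ k" ..
next
  assume "\<exists>C. \<forall>\<^sub>F h in at_right 0. norm (u h - v h) \<le> C * h ^ k"
  then obtain C where "\<forall>\<^sub>F h in at_right 0. norm (u h - v h) \<le> C * h ^ k" ..
  then have "\<forall>\<^sub>F h in at_right 0. norm (norm (u h - v h)) \<le> C * norm (h ^ k)"
    using eventually_at_right_less[of 0] by eventually_elim (simp add: power_abs)
  then show "approx_order k u v"
    unfolding approx_order_def by (rule bigoI)
qed

lemma approx_orderI:
  assumes "\<forall>\<^sub>F h in at_right 0. norm (u h - v h) \<le> C * h ^ k"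
  shows "approx_order k u v"
  using assms approx_order_iff by blast

lemma approx_orderE:
  assumes "approx_order k u v"
  obtains C where "C \<ge> 0" "\<forall>\<^sub>F h in at_right 0. norm (u h - v h) \<le> C * h ^ k"
proof -
  obtain C where C: "\<forall>\<^sub>F h in at_right 0. norm (u h - v h) \<le> C * h ^ k"
    using assms approx_order_iff by blast
  have "\<forall>\<^sub>F h in at_right 0. norm (u h - v h) \<le> \<bar>C\<bar> * h ^ k"
    using C eventually_at_right_less[of 0]
  proof eventually_elim
    case (elim h)
    have "C * h ^ k \<le> \<bar>C\<bar> * h ^ k" using elim by (intro mult_right_mono) auto
    then show ?case using elim by linarith
  qed
  then show thesis using that[of "\<bar>C\<bar>"] by simp
qed

lemma approx_order_cong_ev:
  assumes "\<forall>\<^sub>F h in at_right 0. u h = v h"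
  shows "approx_order k u v"
  by (rule approx_orderI[where C = 0]) (use assms in eventually_elim, simp)

lemma approx_order_refl: "approx_order k u u"
  by (rule approx_order_cong_ev) simp

lemma approx_order_sym: "approx_order k u v \<Longrightarrow> approx_order k v u"
  by (simp add: approx_order_def norm_minus_commute)

lemma approx_order_trans:
  assumes "approx_order k u v" "approx_order k v w"
  shows "approx_order k u w"
proof -
  obtain C where C: "\<forall>\<^sub>F h in at_right 0. norm (u h - v h) \<le> C * h ^ k"
    using assms(1) by (rule approx_orderE)
  obtain D where D: "\<forall>\<^sub>F h in at_right 0. norm (v h - w h) \<le> D * h ^ k"
    using assms(2) by (rule approx_orderE)
  show ?thesis
  proof (rule approx_orderI)
    show "\<forall>\<^sub>F h in at_right 0. norm (u h - w h) \<le> (C + D) * h ^ k"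
      using C D
    proof eventually_elim
      case (elim h)
      then show ?case using norm_triangle_ineq[of "u h - v h" "v h - w h"] by (simp add: algebra_simps)
    qed
  qed
qed

declare approx_order_trans[trans]

text \<open>Eventually \<open>h \<le> 1\<close>, so the higher power of \<open>h\<close> is the
  smaller one.\<close>

lemma approx_order_mono:
  assumes "approx_order k u v" "l \<le> k"
  shows "approx_order l u v"
proof -
  obtain C where C: "C \<ge> 0" "\<forall>\<^sub>F h in at_right 0. norm (u h - v h) \<le> C * h ^ k"
    using assms(1) by (rule approx_orderE)
  have "\<forall>\<^sub>F h in at_right 0. h \<le> (1::real)"
    by (simp add: eventually_at_right_field) (meson less_eq_real_def zero_less_one)
  then have "\<forall>\<^sub>F h in at_right 0. norm (u h - v h) \<le> C * h ^ l"
    using C(2) eventually_at_right_less[of 0]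
  proof eventually_elim
    case (elim h)
    have "C * h ^ k \<le> C * h ^ l"
      using elim C(1) assms(2) by (intro mult_left_mono power_decreasing) auto
    then show ?case using elim by linarith
  qed
  then show ?thesis by (rule approx_orderI)
qed

lemma approx_order_add:
  assumes "approx_order k u v" "approx_order k u' v'"
  shows "approx_order k (\<lambda>h. u h + u' h) (\<lambda>h. v h + v' h)"
proof -
  obtain C where C: "\<forall>\<^sub>F h in at_right 0. norm (u h - v h) \<le> C * h ^ k"
    using assms(1) by (rule approx_orderE)
  obtain D where D: "\<forall>\<^sub>F h in at_right 0. norm (u' h - v' h) \<le> D * h ^ k"
    using assms(2) by (rule approx_orderE)
  show ?thesis
  proof (rule approx_orderI)
    show "\<forall>\<^sub>F h in at_right 0. norm ((u h + u' h) - (v h + v' h)) \<le> (C + D) * h ^ k"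
      using C D
    proof eventually_elim
      case (elim h)
      then show ?case using norm_triangle_ineq[of "u h - v h" "u' h - v' h"]
        by (simp add: algebra_simps)
    qed
  qed
qed

lemma approx_order_sum:
  assumes "\<And>x. x \<in> X \<Longrightarrow> approx_order k (u x) (v x)"
  shows "approx_order k (\<lambda>h. \<Sum>x\<in>X. u x h) (\<lambda>h. \<Sum>x\<in>X. v x h)"
  using assms by (induction X rule: infinite_finite_induct)
    (simp_all add: approx_order_refl approx_order_add)

lemma approx_order_linear:
  fixes L :: "'a::real_normed_vector \<Rightarrow> 'b::real_normed_vector"
  assumes "bounded_linear L" "approx_order k u v"
  shows "approx_order k (\<lambda>h. L (u h)) (\<lambda>h. L (v h))"
proof -
  obtain C where C: "\<forall>\<^sub>F h in at_right 0. norm (u h - v h) \<le> C * h ^ k"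
    using assms(2) by (rule approx_orderE)
  obtain K where K: "K > 0" "\<And>x. norm (L x) \<le> norm x * K"
    using bounded_linear.pos_bounded[OF assms(1)] by blast
  show ?thesis
  proof (rule approx_orderI)
    show "\<forall>\<^sub>F h in at_right 0. norm (L (u h) - L (v h)) \<le> (C * K) * h ^ k"
      using C
    proof eventually_elim
      case (elim h)
      have "norm (L (u h) - L (v h)) \<le> norm (u h - v h) * K"
        using K(2)[of "u h - v h"] linear_diff[OF bounded_linear.linear[OF assms(1)]] by metis
      also have "\<dots> \<le> C * h ^ k * K" using elim K(1) by (intro mult_right_mono) auto
      finally show ?case by (simp add: mult_ac)
    qed
  qed
qed

text \<open>The case \<open>l = 1\<close> is the source of the order gained from the factor
  \<open>h\<close> in the method; general \<open>l\<close> serves the terms \<open>h ^ k\<close>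
  times a \<open>k\<close>-th derivative.\<close>

lemma approx_order_power_scaleR:
  assumes "approx_order k u v"
  shows "approx_order (l + k) (\<lambda>h. h ^ l *\<^sub>R u h) (\<lambda>h. h ^ l *\<^sub>R v h)"
proof -
  obtain C where C: "\<forall>\<^sub>F h in at_right 0. norm (u h - v h) \<le> C * h ^ k"
    using assms by (rule approx_orderE)
  show ?thesis
  proof (rule approx_orderI)
    show "\<forall>\<^sub>F h in at_right 0. norm (h ^ l *\<^sub>R u h - h ^ l *\<^sub>R v h) \<le> C * h ^ (l + k)"
      using C eventually_at_right_less[of 0]
    proof eventually_elim
      case (elim h)
      have "norm (h ^ l *\<^sub>R u h - h ^ l *\<^sub>R v h) = h ^ l * norm (u h - v h)"
        using elim by (simp flip: scaleR_diff_right)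
      also have "\<dots> \<le> h ^ l * (C * h ^ k)" using elim by (intro mult_left_mono) auto
      finally show ?case by (simp add: power_add mult_ac)
    qed
  qed
qed

text \<open>For the converse direction a vector is the sum of its components embedded by
  \<open>axis\<close>, and each embedding is bounded linear.\<close>

lemma approx_order_vec_iff:
  fixes u v :: "real \<Rightarrow> ('a::euclidean_space) ^ 'n"
  shows "approx_order k u v \<longleftrightarrow> (\<forall>i. approx_order k (\<lambda>h. u h $ i) (\<lambda>h. v h $ i))"
proof
  assume "approx_order k u v"
  then show "\<forall>i. approx_order k (\<lambda>h. u h $ i) (\<lambda>h. v h $ i)"
    using approx_order_linear[OF bounded_linear_vec_nth] by blast
next
  assume A: "\<forall>i. approx_order k (\<lambda>h. u h $ i) (\<lambda>h. v h $ i)"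
  have "linear (\<lambda>x::'a. axis i x)" for i :: 'n
    by (rule linearI) (auto simp: axis_def vec_eq_iff)
  then have "bounded_linear (\<lambda>x::'a. axis i x)" for i :: 'n
    by (simp add: linear_conv_bounded_linear)
  then have "approx_order k (\<lambda>h. \<Sum>i\<in>UNIV. axis i (u h $ i)) (\<lambda>h. \<Sum>i\<in>UNIV. axis i (v h $ i))"
    using A by (intro approx_order_sum approx_order_linear[where L = "axis _"]) auto
  moreover have "(\<Sum>i\<in>UNIV. axis i (w $ i)) = w" for w :: "'a ^ 'n"
    by (simp add: vec_eq_iff axis_def)
  ultimately show "approx_order k u v" by simp
qed

section \<open>Lipschitz estimates for smooth functions on balls\<close>

text \<open>The operator norm of the derivative is at most the sum of its norms on the basis. That
  sum depends continuously on the base point, hence is bounded on the compact ball, and the mean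
  value inequality on the convex ball turns the bound into a Lipschitz constant.\<close>

lemma smooth_lipschitz_cball:
  fixes f :: "'a::euclidean_space \<Rightarrow> 'b::euclidean_space"
  assumes "smooth f"
  obtains L where "L \<ge> 0" "\<And>x y. norm x \<le> K \<Longrightarrow> norm y \<le> K \<Longrightarrow> norm (f x - f y) \<le> L * norm (x - y)"
proof -
  let ?D = "\<lambda>x. frechet_derivative f (at x)"
  have "Ck (Suc 0) f" using assms smooth_def by blast
  then have d: "(f has_derivative ?D x) (at x)" and c: "continuous_on UNIV (\<lambda>x. ?D x v)" for x v
    by (simp_all add: frechet_derivative_works)
  have "continuous_on (cball 0 K) (\<lambda>x. \<Sum>b\<in>Basis. norm (?D x b))"
    by (intro continuous_intros continuous_on_subset[OF c]) auto
  then have "bounded ((\<lambda>x. \<Sum>b\<in>Basis. norm (?D x b)) ` cball 0 K)"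
    by (intro compact_imp_bounded compact_continuous_image) auto
  then obtain C where C: "\<And>x. x \<in> cball 0 K \<Longrightarrow> \<bar>\<Sum>b\<in>Basis. norm (?D x b)\<bar> \<le> C"
    unfolding bounded_iff ball_simps real_norm_def by blast
  have "norm (f x - f y) \<le> \<bar>C\<bar> * norm (x - y)" if "norm x \<le> K" "norm y \<le> K" for x y
  proof (rule differentiable_bound[where S = "cball 0 K" and f' = ?D])
    show "onorm (?D z) \<le> \<bar>C\<bar>" if "z \<in> cball 0 K" for z
      using onorm_componentwise[OF has_derivative_bounded_linear[OF d[of z]]] C[OF that] by linarith
  qed (use that d in \<open>auto intro: has_derivative_at_withinI\<close>)
  then show thesis using that[of "\<bar>C\<bar>"] by simp
qed

text \<open>Boundedness passes from \<open>v\<close> to \<open>u\<close> because order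
  \<open>k\<close> implies order 0. Both families then stay in one ball, on which \<open>f\<close>
  is Lipschitz.\<close>

lemma approx_order_smooth:
  fixes f :: "'a::euclidean_space \<Rightarrow> 'b::euclidean_space"
  assumes "smooth f" "approx_order k u v" "approx_order 0 v (\<lambda>_. 0)"
  shows "approx_order k (\<lambda>h. f (u h)) (\<lambda>h. f (v h))"
proof -
  have "approx_order 0 u (\<lambda>_. 0)"
    using approx_order_trans[OF approx_order_mono[OF assms(2)] assms(3)] by simp
  then obtain Cu where Cu: "\<forall>\<^sub>F h in at_right 0. norm (u h) \<le> Cu"
    by (auto simp: approx_order_iff)
  obtain Cv where Cv: "\<forall>\<^sub>F h in at_right 0. norm (v h) \<le> Cv"
    using assms(3) by (auto simp: approx_order_iff)
  obtain C where C: "\<forall>\<^sub>F h in at_right 0. norm (u h - v h) \<le> C * h ^ k"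
    using assms(2) by (rule approx_orderE)
  obtain L where L: "L \<ge> 0" "\<And>x y. norm x \<le> max Cu Cv \<Longrightarrow> norm y \<le> max Cu Cv
      \<Longrightarrow> norm (f x - f y) \<le> L * norm (x - y)"
    using smooth_lipschitz_cball[OF assms(1)] by blast
  show ?thesis
  proof (rule approx_orderI)
    show "\<forall>\<^sub>F h in at_right 0. norm (f (u h) - f (v h)) \<le> (L * C) * h ^ k"
      using Cu Cv C
    proof eventually_elim
      case (elim h)
      have "norm (f (u h) - f (v h)) \<le> L * norm (u h - v h)" using elim by (intro L) auto
      also have "\<dots> \<le> L * (C * h ^ k)" using elim L(1) by (intro mult_left_mono)
      finally show ?case by simp
    qed
  qed
qed

section \<open>Closure properties of \<open>Ck\<close> and of smooth functions\<close>

lemma Ck_const: "Ck k (\<lambda>_. c)"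
proof (induction k arbitrary: c)
  case (Suc k)
  then show ?case by simp
qed simp

text \<open>\<open>Ck\<close> refers to the chosen \<open>frechet_derivative\<close>; by uniqueness
  of the derivative, any explicit \<open>f'\<close> may take its place.\<close>

lemma Ck_SucI:
  assumes "\<And>x. (f has_derivative f' x) (at x)" "\<And>v. Ck k (\<lambda>x. f' x v)"
  shows "Ck (Suc k) f"
proof -
  have "frechet_derivative f (at x) = f' x" for x
    by (rule frechet_derivative_at[OF assms(1), symmetric])
  then show ?thesis using assms by (auto simp: differentiable_def)
qed

lemma Ck_SucD:
  assumes "Ck (Suc k) f"
  shows "(f has_derivative frechet_derivative f (at x)) (at x)"
    and "Ck k (\<lambda>x. frechet_derivative f (at x) v)"
  using assms by (simp_all add: frechet_derivative_works)

lemma Ck_imp_continuous: "Ck k f \<Longrightarrow> continuous_on UNIV f"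
  by (cases k) (auto intro!: differentiable_imp_continuous_on differentiable_at_imp_differentiable_on)

lemma Ck_Suc_imp: "Ck (Suc k) f \<Longrightarrow> Ck k f"
proof (induction k arbitrary: f)
  case 0
  then show ?case using Ck_imp_continuous Ck.simps(1) by blast
next
  case (Suc k)
  show ?case
    by (rule Ck_SucI[OF Ck_SucD(1)[OF Suc.prems]]) (rule Suc.IH[OF Ck_SucD(2)[OF Suc.prems]])
qed

lemma Ck_add: "Ck k f \<Longrightarrow> Ck k g \<Longrightarrow> Ck k (\<lambda>x. f x + g x)"
proof (induction k arbitrary: f g)
  case (Suc k)
  show ?case
    by (rule Ck_SucI[OF has_derivative_add[OF Ck_SucD(1)[OF Suc.prems(1)] Ck_SucD(1)[OF Suc.prems(2)]]])
       (rule Suc.IH[OF Ck_SucD(2)[OF Suc.prems(1)] Ck_SucD(2)[OF Suc.prems(2)]])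
qed (auto intro: continuous_intros)

lemma Ck_sum: "(\<And>i. i \<in> I \<Longrightarrow> Ck k (f i)) \<Longrightarrow> Ck k (\<lambda>x. \<Sum>i\<in>I. f i x)"
  by (induction I rule: infinite_finite_induct) (simp_all add: Ck_const Ck_add)

lemma Ck_scaleR: "Ck k f \<Longrightarrow> Ck k g \<Longrightarrow> Ck k (\<lambda>x. f x *\<^sub>R g x)"
proof (induction k arbitrary: f g)
  case (Suc k)
  \<comment> \<open>Each summand of the product rule contains \<open>f\<close> or \<open>g\<close>
    undifferentiated, so the induction hypothesis also needs these at level
    \<open>k\<close>.\<close>
  have "Ck k f" "Ck k g" using Suc.prems Ck_Suc_imp by blast+
  then show ?case
    by (intro Ck_SucI[OF has_derivative_scaleR[OF Ck_SucD(1)[OF Suc.prems(1)] Ck_SucD(1)[OF Suc.prems(2)]]]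
        Ck_add Suc.IH Ck_SucD(2) Suc.prems)
qed (auto intro: continuous_intros)

lemma Ck_bounded_linear_comp:
  assumes "bounded_linear L"
  shows "Ck k f \<Longrightarrow> Ck k (\<lambda>x. L (f x))"
proof (induction k arbitrary: f)
  case (Suc k)
  show ?case
    by (rule Ck_SucI[OF bounded_linear.has_derivative[OF assms Ck_SucD(1)[OF Suc.prems]]])
       (rule Suc.IH[OF Ck_SucD(2)[OF Suc.prems]])
qed (auto intro: continuous_on_compose2[OF linear_continuous_on[OF assms]])

lemma smooth_id: "smooth (\<lambda>x. x)"
proof -
  have "Ck k (\<lambda>x::'a. x)" for k
    by (cases k) (auto intro: Ck_SucI[OF has_derivative_ident] Ck_const)
  then show ?thesis by (simp add: smooth_def)
qed

lemma smooth_add: "smooth f \<Longrightarrow> smooth g \<Longrightarrow> smooth (\<lambda>x. f x + g x)"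
  by (simp add: smooth_def Ck_add)

lemma smooth_continuous_on: "smooth f \<Longrightarrow> continuous_on S f"
  unfolding smooth_def by (metis Ck.simps(1) continuous_on_subset subset_UNIV)

text \<open>\<open>Ck\<close> controls the derivative in fixed directions only, whereas the
  direction \<open>F x\<close> varies. Expanding \<open>F x\<close> in the basis leaves products of
  smooth coefficients with derivatives in fixed directions.\<close>

lemma smooth_lie_derivative:
  assumes "smooth G" "smooth F"
  shows "smooth (\<lambda>x. frechet_derivative G (at x) (F x))"
proof -
  have "frechet_derivative G (at x) (F x)
      = (\<Sum>b\<in>Basis. (F x \<bullet> b) *\<^sub>R frechet_derivative G (at x) b)" for x
  proof -
    have "G differentiable (at x)" using assms(1) unfolding smooth_def by (metis Ck.simps(2))
    then have "linear (frechet_derivative G (at x))" by (rule linear_frechet_derivative)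
    then have "frechet_derivative G (at x) (\<Sum>b\<in>Basis. (F x \<bullet> b) *\<^sub>R b)
        = (\<Sum>b\<in>Basis. (F x \<bullet> b) *\<^sub>R frechet_derivative G (at x) b)"
      by (simp add: linear_sum linear_cmul)
    then show ?thesis by (simp add: euclidean_representation)
  qed
  moreover have "Ck k (\<lambda>x. \<Sum>b\<in>Basis. (F x \<bullet> b) *\<^sub>R frechet_derivative G (at x) b)" for k
  proof -
    have "Ck (Suc k) G" "Ck k F" using assms smooth_def by blast+
    then show ?thesis
      by (auto intro!: Ck_sum Ck_scaleR Ck_bounded_linear_comp[where L = "\<lambda>z. z \<bullet> _"]
          bounded_linear_inner_left)
  qed
  ultimately show ?thesis by (simp add: smooth_def)
qed

section \<open>Iterated derivatives along a solution and Taylor's formula\<close>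

lemma nth_derivative_0: "nth_derivative 0 y = y"
  by (simp add: nth_derivative_def)

lemma nth_derivative_Suc: "nth_derivative (Suc k) y t = vector_derivative (nth_derivative k y) (at t)"
  by (simp add: nth_derivative_def)

text \<open>Along a solution of \<open>y' = F y\<close>, differentiation acts on functions of the state as the Lie
  derivative along \<open>F\<close>, which preserves smoothness.\<close>

lemma nth_derivative_along_solution:
  assumes "smooth F" "open J" "ode_solution_on J F y" "smooth G" "t \<in> J"
  shows "(nth_derivative k (\<lambda>t. G (y t)) has_vector_derivative
           nth_derivative (Suc k) (\<lambda>t. G (y t)) t) (at t)"
proof -
  let ?N = "\<lambda>k. nth_derivative k (\<lambda>t. G (y t))"
  have deriv: "((\<lambda>t. H (y t)) has_vector_derivative frechet_derivative H (at (y t)) (F (y t))) (at t)"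
    if "smooth H" "t \<in> J" for H :: "real ^ 'a \<Rightarrow> 'b" and t
  proof -
    have "H differentiable (at (y t))" using that(1) unfolding smooth_def by (metis Ck.simps(2))
    then have "(H has_derivative frechet_derivative H (at (y t))) (at (y t))"
      by (simp add: frechet_derivative_works)
    then have "(H has_derivative frechet_derivative H (at (y t))) (at (y t) within y ` UNIV)"
      by (rule has_derivative_at_withinI)
    moreover have "(y has_vector_derivative F (y t)) (at t)"
      using assms(3) that(2) by (simp add: ode_solution_on_def)
    ultimately show ?thesis
      using vector_derivative_diff_chain_within[of y "F (y t)" t UNIV H] by (simp add: o_def)
  qed
  \<comment> \<open>The identity with \<open>H (y t)\<close> is available on \<open>J\<close> only;
    as \<open>J\<close> is open, it holds near \<open>t\<close>, which is enough to transfer the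
    derivative.\<close>
  have step: "(?N k has_vector_derivative frechet_derivative H (at (y t)) (F (y t))) (at t)"
    if "smooth H" "\<forall>t\<in>J. ?N k t = H (y t)" "t \<in> J" for H k t
    by (rule has_vector_derivative_transform_within_open[OF deriv[OF that(1,3)] assms(2) that(3)])
       (use that(2) in simp)
  have "\<exists>H. smooth H \<and> (\<forall>t\<in>J. ?N k t = H (y t))" for k
  proof (induction k)
    case 0
    show ?case using assms(4) by (auto simp: nth_derivative_def)
  next
    case (Suc k)
    then obtain H where H: "smooth H" "\<forall>t\<in>J. ?N k t = H (y t)" by blast
    have "\<forall>t\<in>J. ?N (Suc k) t = frechet_derivative H (at (y t)) (F (y t))"
      unfolding nth_derivative_Suc using step[OF H] by (blast intro: vector_derivative_at)
    with smooth_lie_derivative[OF H(1) assms(1)] show ?case by blast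
  qed
  then obtain H where H: "smooth H" "\<forall>t\<in>J. ?N k t = H (y t)" by blast
  show ?thesis
    unfolding nth_derivative_Suc
    using step[OF H assms(5)] by (simp add: vector_derivative_at)
qed

text \<open>The constant is uniform in the expansion point \<open>t\<close> too, because the base
  point of a step moves with \<open>h\<close>. Induction on \<open>N\<close> for all
  \<open>j\<close>: the remainder of \<open>D j\<close> with \<open>Suc N\<close> terms vanishes at
  \<open>t\<close>, and its derivative is the remainder of \<open>D (Suc j)\<close> with
  \<open>N\<close> terms, so the mean value inequality gives one more factor
  \<open>\<bar>x - t\<bar>\<close>.\<close>

lemma taylor_bound:
  fixes D :: "nat \<Rightarrow> real \<Rightarrow> 'a::real_normed_vector"
  assumes D: "\<And>k t. t \<in> cball t0 d \<Longrightarrow> (D k has_vector_derivative D (Suc k) t) (at t)"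
  shows "\<exists>C\<ge>0. \<forall>x\<in>cball t0 d. \<forall>t\<in>cball t0 d.
    norm (D j x - (\<Sum>k<N. ((x - t) ^ k / fact k) *\<^sub>R D (j + k) t)) \<le> C * \<bar>x - t\<bar> ^ N"
proof (induction N arbitrary: j)
  case 0
  have "continuous_on (cball t0 d) (D j)"
    by (intro continuous_at_imp_continuous_on ballI has_vector_derivative_continuous[OF D])
  then have "bounded (D j ` cball t0 d)"
    by (intro compact_imp_bounded compact_continuous_image) auto
  then obtain C where "\<forall>x\<in>cball t0 d. norm (D j x) \<le> C" by (auto simp: bounded_iff)
  then show ?case by (intro exI[of _ "\<bar>C\<bar>"]) fastforce
next
  case (Suc N)
  obtain C where C: "C \<ge> 0" "\<forall>x\<in>cball t0 d. \<forall>t\<in>cball t0 d.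
    norm (D (Suc j) x - (\<Sum>k<N. ((x - t) ^ k / fact k) *\<^sub>R D (Suc j + k) t)) \<le> C * \<bar>x - t\<bar> ^ N"
    using Suc.IH[of "Suc j"] by blast
  have "norm (D j x - (\<Sum>k<Suc N. ((x - t) ^ k / fact k) *\<^sub>R D (j + k) t)) \<le> C * \<bar>x - t\<bar> ^ Suc N"
    if x: "x \<in> cball t0 d" and t: "t \<in> cball t0 d" for x t
  proof -
    let ?r = "\<lambda>z. D j z - (\<Sum>k<Suc N. ((z - t) ^ k / fact k) *\<^sub>R D (j + k) t)"
    let ?r' = "\<lambda>z. D (Suc j) z - (\<Sum>k<N. ((z - t) ^ k / fact k) *\<^sub>R D (Suc j + k) t)"
    have sub: "closed_segment t x \<subseteq> cball t0 d"
      using x t by (intro closed_segment_subset) auto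
    have der: "(?r has_vector_derivative ?r' z) (at z)" if "z \<in> cball t0 d" for z
    proof -
      have "((\<lambda>z. \<Sum>k<N. ((z - t) ^ Suc k / fact (Suc k)) *\<^sub>R D (j + Suc k) t)
          has_vector_derivative (\<Sum>k<N. ((z - t) ^ k / fact k) *\<^sub>R D (j + Suc k) t)) (at z)"
      proof (intro has_vector_derivative_sum)
        fix k
        have "((\<lambda>z. (z - t) ^ Suc k / fact (Suc k)) has_field_derivative (z - t) ^ k / fact k) (at z)"
        proof -
          have "((\<lambda>z. (z - t) ^ Suc k / fact (Suc k)) has_field_derivative
              real (Suc k) * (z - t) ^ k / (real (Suc k) * fact k)) (at z)"
            by (auto intro!: derivative_eq_intros simp del: power_Suc of_nat_Suc)
          then show ?thesis by (simp only: mult_divide_mult_cancel_left_if) simp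
        qed
        then show "((\<lambda>z. ((z - t) ^ Suc k / fact (Suc k)) *\<^sub>R D (j + Suc k) t)
            has_vector_derivative ((z - t) ^ k / fact k) *\<^sub>R D (j + Suc k) t) (at z)"
          using has_vector_derivative_scaleR[OF _ has_vector_derivative_const] by fastforce
      qed
      \<comment> \<open>The term \<open>k = 0\<close> is constant in \<open>z\<close> and
        contributes the explicit 0; the other terms shift down by one index.\<close>
      then have "(?r has_vector_derivative
          D (Suc j) z - (0 + (\<Sum>k<N. ((z - t) ^ k / fact k) *\<^sub>R D (j + Suc k) t))) (at z)"
        unfolding sum.lessThan_Suc_shift
        by (intro has_vector_derivative_diff has_vector_derivative_add D that) simp_all
      then show ?thesis by simp
    qed
    \<comment> \<open>On the segment \<open>\<bar>z - t\<bar> \<le> \<bar>x - t\<bar>\<close>, so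
      the bound on the derivative can be taken independent of \<open>z\<close>.\<close>
    have "norm (?r x - ?r t) \<le> (C * \<bar>x - t\<bar> ^ N) * norm (x - t)"
    proof (rule differentiable_bound[where S = "closed_segment t x" and f' = "\<lambda>z w. w *\<^sub>R ?r' z"])
      show "(?r has_derivative (\<lambda>w. w *\<^sub>R ?r' z)) (at z within closed_segment t x)"
        if "z \<in> closed_segment t x" for z
        using der[of z] sub that unfolding has_vector_derivative_def
        by (blast intro: has_derivative_at_withinI)
      show "onorm (\<lambda>w. w *\<^sub>R ?r' z) \<le> C * \<bar>x - t\<bar> ^ N" if "z \<in> closed_segment t x" for z
      proof -
        have "onorm (\<lambda>w::real. w *\<^sub>R ?r' z) = norm (?r' z)"
          by (simp add: onorm_scaleR_left[OF bounded_linear_ident] onorm_id)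
        also have "\<dots> \<le> C * \<bar>z - t\<bar> ^ N" using C(2) sub that t by blast
        also have "\<dots> \<le> C * \<bar>x - t\<bar> ^ N"
          using segment_bound1[OF that] C(1)
          by (intro mult_left_mono power_mono) auto
        finally show ?thesis .
      qed
    qed auto
    moreover have "?r t = 0" by (simp add: sum.lessThan_Suc_shift del: sum.lessThan_Suc)
    ultimately show ?thesis by (simp add: mult_ac)
  qed
  then show ?case using C(1) by blast
qed

section \<open>Kronecker products and the common form of stage and output equations\<close>

lemma kron_I_nth: "kron_I M Y $ i = (\<Sum>j\<in>UNIV. M $ i $ j *\<^sub>R Y $ j)"
  by (simp add: kron_I_def)

lemma blockwise_nth: "blockwise f Y $ i = f (Y $ i)"
  by (simp add: blockwise_def)

lemma bounded_linear_kron_I: "bounded_linear (kron_I M :: (real ^ 'm) ^ 'a \<Rightarrow> (real ^ 'm) ^ 'b)"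
  unfolding linear_conv_bounded_linear[symmetric]
  by (rule linearI)
     (simp_all add: vec_eq_iff kron_I_def scaleR_add_right sum.distrib sum_distrib_left mult_ac)

lemma vec_power_nth: "((v :: real ^ 'n) ^ k) $ i = v $ i ^ k"
  by (induction k) auto

text \<open>This lets \<open>A ** \<alpha>\<close> and \<open>A ** \<beta>\<close> in the method be
  read as \<open>A\<close> acting on extrapolated values of \<open>f\<close>; the proof is an
  exchange of two sums.\<close>

lemma kron_I_mult: "kron_I (M ** N) Y = kron_I M (kron_I N Y)"
proof -
  have "(\<Sum>j\<in>UNIV. (\<Sum>k\<in>UNIV. M $ i $ k * N $ k $ j) *\<^sub>R Y $ j)
      = (\<Sum>k\<in>UNIV. M $ i $ k *\<^sub>R (\<Sum>j\<in>UNIV. N $ k $ j *\<^sub>R Y $ j))" for i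
    by (simp only: scaleR_sum_left scaleR_sum_right scaleR_scaleR) (rule sum.swap)
  then show ?thesis
    by (simp only: vec_eq_iff kron_I_nth matrix_matrix_mult_def vec_lambda_beta) simp
qed

text \<open>The pair \<open>(A, U)\<close> yields the right-hand side of the stage equations and
  \<open>(B, V)\<close> the output, so one expansion serves both. With \<open>M\<close> factored
  out, the extrapolated values of \<open>f\<close> stand next to those of \<open>g\<close>.\<close>

definition imex_update ::
  "real ^ 's ^ 'a \<Rightarrow> real ^ 'r ^ 'a \<Rightarrow> real ^ 's ^ 's \<Rightarrow> real ^ 's ^ 's \<Rightarrow>
   (real ^ 'm \<Rightarrow> real ^ 'm) \<Rightarrow> (real ^ 'm \<Rightarrow> real ^ 'm) \<Rightarrow> real \<Rightarrow>
   (real ^ 'm) ^ 's \<Rightarrow> (real ^ 'm) ^ 'r \<Rightarrow> (real ^ 'm) ^ 's \<Rightarrow> (real ^ 'm) ^ 'a"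
where
  "imex_update M N \<alpha> \<beta> f g h Yold yold Z =
     h *\<^sub>R kron_I M (kron_I \<alpha> (blockwise f Yold) + kron_I \<beta> (blockwise f Z) + blockwise g Z)
     + kron_I N yold"

lemma kron_I_add: "kron_I M (X + Y) = kron_I M X + kron_I M Y"
  using bounded_linear_kron_I bounded_linear.linear linear_add by blast

lemma imex_stages_iff_update:
  "imex_stages A U \<alpha> \<beta> f g h Yold yold Z \<longleftrightarrow> Z = imex_update A U \<alpha> \<beta> f g h Yold yold Z"
  by (simp add: imex_stages_def imex_update_def kron_I_mult kron_I_add scaleR_add_right)

lemma imex_output_eq_update:
  "imex_output B V \<alpha> \<beta> f g h Yold yold Z = imex_update B V \<alpha> \<beta> f g h Yold yold Z"
  by (simp add: imex_output_def imex_update_def kron_I_mult kron_I_add scaleR_add_right)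

section \<open>Existence of bounded stage solutions\<close>

lemma continuous_on_kron_I:
  fixes X :: "'z::topological_space \<Rightarrow> (real ^ 'm) ^ 'a"
  assumes "continuous_on S X"
  shows "continuous_on S (\<lambda>z. kron_I M (X z))"
  by (rule continuous_on_compose2[OF linear_continuous_on[OF bounded_linear_kron_I] assms]) auto

lemma continuous_on_blockwise:
  fixes X :: "'z::topological_space \<Rightarrow> (real ^ 'm) ^ 'a"
  assumes "continuous_on UNIV f" "continuous_on S X"
  shows "continuous_on S (\<lambda>z. blockwise f (X z))"
  unfolding blockwise_def
  by (intro continuous_on_vec_lambda continuous_on_compose2[OF assms(1)] continuous_on_component assms(2)) auto

text \<open>For small \<open>h\<close> the right-hand side of the stage equations maps a fixed ball into itself, so
  Brouwer's theorem provides a solution.\<close>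

lemma bounded_stage_solution_exists:
  fixes f g :: "real ^ 'm \<Rightarrow> real ^ 'm"
  assumes f: "continuous_on UNIV f" and g: "continuous_on UNIV g"
    and Yold: "approx_order 0 Yold (\<lambda>_. 0)" and yold: "approx_order 0 yold (\<lambda>_. 0)"
  shows "\<exists>Ynew. bounded_stage_solution A U \<alpha> \<beta> f g Yold yold Ynew"
proof -
  obtain K1 where K1: "\<forall>\<^sub>F h in at_right 0. norm (Yold h) \<le> K1"
    using Yold by (auto simp: approx_order_iff)
  have "approx_order 0 (\<lambda>h. kron_I U (yold h)) (\<lambda>h. kron_I U 0)"
    by (rule approx_order_linear[OF bounded_linear_kron_I yold])
  moreover have "kron_I U 0 = (0 :: (real ^ 'm) ^ 'a)" by (simp add: vec_eq_iff kron_I_def)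
  ultimately obtain K2 where K2: "K2 \<ge> 0" "\<forall>\<^sub>F h in at_right 0. norm (kron_I U (yold h)) \<le> K2"
    by (elim approx_orderE) auto
  \<comment> \<open>\<open>K2\<close> bounds the contribution of \<open>yold\<close>; the extra 1
    leaves room for the term with the factor \<open>h\<close>.\<close>
  define R where "R = K2 + 1"
  \<comment> \<open>\<open>E\<close> does not involve \<open>h\<close>, so a single bound on a
    compact product of balls serves all small step sizes.\<close>
  define E where "E = (\<lambda>(Y, Z). kron_I A (kron_I \<alpha> (blockwise f Y) + kron_I \<beta> (blockwise f Z) + blockwise g Z))"
  have contE: "continuous_on S E" for S
    unfolding E_def split_def
    by (intro continuous_on_kron_I continuous_on_add continuous_on_blockwise f g
        continuous_on_fst continuous_on_snd continuous_on_id)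
  have "bounded (E ` (cball 0 K1 \<times> cball 0 R))"
    by (intro compact_imp_bounded compact_continuous_image compact_Times compact_cball contE)
  then obtain C where "\<forall>x\<in>E ` (cball 0 K1 \<times> cball 0 R). norm x \<le> C"
    unfolding bounded_iff by blast
  then have C: "norm (E (Y, Z)) \<le> C" if "norm Y \<le> K1" "norm Z \<le> R" for Y Z
    using that by simp
  have "((\<lambda>h. h * C) \<longlongrightarrow> 0 * C) (at_right 0)"
    by (intro tendsto_intros)
  then have small: "\<forall>\<^sub>F h in at_right 0. h * C < 1"
    by (intro order_tendstoD) auto
  \<comment> \<open>Keeping the radius in \<open>?P\<close> lets one choice per step size produce a
    family that both solves the equations and is bounded.\<close>
  let ?P = "\<lambda>h Z. norm Z \<le> R \<and> imex_stages A U \<alpha> \<beta> f g h (Yold h) (yold h) Z"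
  have ev: "\<forall>\<^sub>F h in at_right 0. \<exists>Z. ?P h Z"
    using K1 K2(2) small eventually_at_right_less[of 0]
  proof eventually_elim
    case (elim h)
    let ?G = "\<lambda>Z. imex_update A U \<alpha> \<beta> f g h (Yold h) (yold h) Z"
    have G: "?G Z = h *\<^sub>R E (Yold h, Z) + kron_I U (yold h)" for Z
      by (simp add: imex_update_def E_def)
    have "continuous_on (cball 0 R) ?G"
      unfolding G by (intro continuous_intros continuous_on_compose2[OF contE[of UNIV]]) auto
    moreover have "?G \<in> cball 0 R \<rightarrow> cball 0 R"
    proof
      fix Z :: "(real ^ 'm) ^ 'a" assume "Z \<in> cball 0 R"
      then have "norm (E (Yold h, Z)) \<le> C" using C elim by simp
      then have "h * norm (E (Yold h, Z)) \<le> h * C" using elim(4) by (intro mult_left_mono) auto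
      moreover have "norm (h *\<^sub>R E (Yold h, Z)) = h * norm (E (Yold h, Z))" using elim by simp
      ultimately have "norm (h *\<^sub>R E (Yold h, Z)) \<le> 1" using elim(3) by linarith
      then show "?G Z \<in> cball 0 R"
        using norm_triangle_ineq[of "h *\<^sub>R E (Yold h, Z)" "kron_I U (yold h)"] elim
        by (simp add: G R_def)
    qed
    moreover have "cball 0 R \<noteq> ({} :: ((real ^ 'm) ^ 'a) set)" using K2(1) by (simp add: R_def)
    ultimately obtain Z where "Z \<in> cball 0 R" "?G Z = Z"
      using brouwer[OF compact_cball convex_cball] by blast
    then show ?case by (metis imex_stages_iff_update mem_cball_0)
  qed
  have "\<forall>\<^sub>F h in at_right 0. ?P h (SOME Z. ?P h Z)"
    using ev by eventually_elim (rule someI_ex)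
  then show ?thesis
    unfolding bounded_stage_solution_def
    by (intro exI[of _ "\<lambda>h. SOME Z. ?P h Z"] conjI exI[of _ R]; eventually_elim) auto
qed

section \<open>Taylor expansions around the moving base point of a step\<close>

locale ode_step =
  fixes f g :: "real ^ 'm \<Rightarrow> real ^ 'm" and J :: "real set" and y :: "real \<Rightarrow> real ^ 'm"
    and t0 :: real and n :: nat
  assumes smooth_f: "smooth f" and smooth_g: "smooth g"
    and open_J: "open J" and t0_in_J: "t0 \<in> J"
    and solution: "ode_solution_on J (\<lambda>x. f x + g x) y"
begin

abbreviation tn :: "real \<Rightarrow> real" where
  "tn h \<equiv> t0 + real n * h"

text \<open>Abscissae are relative to \<open>tn h\<close>: \<open>d = c\<close> gives the targets of
  the new stages and \<open>d = c - 1\<close> those of the old ones.\<close>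

definition exact_stages :: "real ^ 's \<Rightarrow> real \<Rightarrow> (real ^ 'm) ^ 's" where
  "exact_stages d h = (\<chi> i. y (tn h + d $ i * h))"

text \<open>As \<open>n\<close> and \<open>a\<close> are fixed, all points of the step converge to
  \<open>t0\<close>.\<close>

lemma eventually_in_ball:
  assumes "d > 0"
  shows "\<forall>\<^sub>F h in at_right 0. tn h + a * h \<in> cball t0 d"
proof -
  have "((\<lambda>h. tn h + a * h) \<longlongrightarrow> t0 + real n * 0 + a * 0) (at_right 0)"
    by (intro tendsto_intros)
  then have "\<forall>\<^sub>F h in at_right 0. dist (tn h + a * h) t0 < d"
    using assms by (intro tendstoD) auto
  then show ?thesis by eventually_elim (simp add: dist_commute)
qed

text \<open>Both \<open>tn h\<close> and \<open>tn h + a * h\<close> lie in one ball inside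
  \<open>J\<close> for small \<open>h\<close>, so the uniform remainder bound applies although the
  base point moves.\<close>

lemma taylor:
  fixes G :: "real ^ 'm \<Rightarrow> 'b::euclidean_space"
  assumes "smooth G"
  shows "approx_order N (\<lambda>h. nth_derivative j (\<lambda>t. G (y t)) (tn h + a * h))
    (\<lambda>h. \<Sum>k<N. (a ^ k / fact k * h ^ k) *\<^sub>R nth_derivative (j + k) (\<lambda>t. G (y t)) (tn h))"
proof -
  let ?D = "\<lambda>k. nth_derivative k (\<lambda>t. G (y t))"
  obtain d where d: "d > 0" "cball t0 d \<subseteq> J"
    using open_J t0_in_J open_contains_cball by blast
  have "(?D k has_vector_derivative ?D (Suc k) t) (at t)" if "t \<in> cball t0 d" for k t
    using nth_derivative_along_solution[OF smooth_add[OF smooth_f smooth_g] open_J solution assms] d that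
    by blast
  then obtain C where C: "C \<ge> 0" "\<forall>x\<in>cball t0 d. \<forall>t\<in>cball t0 d.
    norm (?D j x - (\<Sum>k<N. ((x - t) ^ k / fact k) *\<^sub>R ?D (j + k) t)) \<le> C * \<bar>x - t\<bar> ^ N"
    using taylor_bound[where D = ?D and j = j and N = N] by blast
  have tn: "\<forall>\<^sub>F h in at_right 0. tn h \<in> cball t0 d"
    using eventually_in_ball[OF d(1), of 0] by simp
  show ?thesis
  proof (rule approx_orderI)
    show "\<forall>\<^sub>F h in at_right 0. norm (?D j (tn h + a * h)
        - (\<Sum>k<N. (a ^ k / fact k * h ^ k) *\<^sub>R ?D (j + k) (tn h))) \<le> (C * \<bar>a\<bar> ^ N) * h ^ N"
      using tn eventually_in_ball[OF d(1), of a] eventually_at_right_less[of 0]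
    proof eventually_elim
      case (elim h)
      then have "norm (?D j (tn h + a * h)
          - (\<Sum>k<N. (((tn h + a * h) - tn h) ^ k / fact k) *\<^sub>R ?D (j + k) (tn h)))
          \<le> C * \<bar>(tn h + a * h) - tn h\<bar> ^ N"
        using C(2) by blast
      then show ?case using elim(3) by (simp add: power_mult_distrib abs_mult mult_ac)
    qed
  qed
qed

lemmas taylor_solution = taylor[OF smooth_id]

text \<open>This is Taylor's formula with \<open>N = 0\<close> and \<open>a = 0\<close>, where the
  sum is empty.\<close>

lemma derivative_bounded: "approx_order 0 (\<lambda>h. nth_derivative k y (tn h)) (\<lambda>_. 0)"
  using taylor_solution[of 0 k 0] by simp

lemma exact_stages_bounded: "approx_order 0 (exact_stages d) (\<lambda>_. 0)"
  using taylor_solution[of 0 0] by (simp add: approx_order_vec_iff exact_stages_def nth_derivative_0)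

lemma taylor_term: "approx_order k (\<lambda>h. (a * h ^ k) *\<^sub>R nth_derivative k y (tn h)) (\<lambda>_. 0)"
proof -
  have "approx_order 0 (\<lambda>h. a *\<^sub>R nth_derivative k y (tn h)) (\<lambda>_. a *\<^sub>R 0)"
    by (rule approx_order_linear[OF bounded_linear_scaleR_right derivative_bounded])
  from approx_order_power_scaleR[OF this, of k] show ?thesis by (simp add: mult.commute)
qed

text \<open>Every dropped term has \<open>k \<ge> Suc K\<close> and is
  \<open>O(h^k)\<close>.\<close>

lemma taylor_truncate:
  assumes "K \<le> p"
  shows "approx_order (Suc K) (\<lambda>h. \<Sum>k\<le>p. (a k * h ^ k) *\<^sub>R nth_derivative k y (tn h))
    (\<lambda>h. \<Sum>k\<le>K. (a k * h ^ k) *\<^sub>R nth_derivative k y (tn h))"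
proof -
  let ?u = "\<lambda>k h. (a k * h ^ k) *\<^sub>R nth_derivative k y (tn h)"
  have "approx_order (Suc K) (?u k) (\<lambda>h. if k \<le> K then ?u k h else 0)" for k
    using approx_order_mono[OF taylor_term[where k = k and a = "a k"], of "Suc K"]
    by (cases "k \<le> K") (simp_all add: approx_order_refl)
  then have "approx_order (Suc K) (\<lambda>h. \<Sum>k\<le>p. ?u k h) (\<lambda>h. \<Sum>k\<le>p. if k \<le> K then ?u k h else 0)"
    by (intro approx_order_sum)
  moreover have "(\<Sum>k\<le>p. if k \<le> K then ?u k h else 0) = (\<Sum>k\<le>K. ?u k h)" for h
    using assms by (intro sum.mono_neutral_cong_right) auto
  ultimately show ?thesis by simp
qed

lemma blockwise_approx:
  assumes "smooth G" "approx_order k Z (exact_stages d)"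
  shows "approx_order k (\<lambda>h. blockwise G (Z h)) (\<lambda>h. blockwise G (exact_stages d h))"
proof -
  have "approx_order k (\<lambda>h. Z h $ i) (\<lambda>h. exact_stages d h $ i)"
    and "approx_order 0 (\<lambda>h. exact_stages d h $ i) (\<lambda>_. 0)" for i
    using approx_order_linear[OF bounded_linear_vec_nth assms(2)]
      approx_order_linear[OF bounded_linear_vec_nth exact_stages_bounded[of d]] by simp_all
  from approx_order_smooth[OF assms(1) this] show ?thesis
    by (subst approx_order_vec_iff) (simp add: blockwise_nth)
qed

section \<open>Extrapolation error and expansions of the computed and the exact output\<close>

text \<open>Expanding \<open>G (y t)\<close> about \<open>tn h\<close>, the coefficients of the
  \<open>k\<close>-th derivative on the two sides agree by the \<open>k\<close>-th extrapolation
  condition. The conditions cover all \<open>k < p\<close>, exactly the terms kept before the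
  \<open>O(h^p)\<close> remainder.\<close>

lemma extrapolation_exact:
  assumes "extrapolation_order p c \<alpha> \<beta>" "smooth G"
  shows "approx_order p
    (\<lambda>h. kron_I \<alpha> (blockwise G (exact_stages (c - 1) h)) + kron_I \<beta> (blockwise G (exact_stages c h)))
    (\<lambda>h. blockwise G (exact_stages c h))"
proof -
  let ?D = "\<lambda>k. nth_derivative k (\<lambda>t. G (y t))"
  let ?T = "\<lambda>a h. \<Sum>k<p. (a ^ k / fact k * h ^ k) *\<^sub>R ?D k (tn h)"
  have T: "approx_order p (\<lambda>h. G (y (tn h + a * h))) (?T a)" for a
    using taylor[OF assms(2), of p 0 a] by (simp add: nth_derivative_0)
  have row: "(\<Sum>j\<in>UNIV. \<alpha> $ i $ j * (c $ j - 1) ^ k) + (\<Sum>j\<in>UNIV. \<beta> $ i $ j * c $ j ^ k) = c $ i ^ k"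
    if "k < p" for i k
  proof -
    have "(\<alpha> *v (c - 1) ^ k + \<beta> *v c ^ k) $ i = (c ^ k) $ i"
      using assms(1) that by (simp add: extrapolation_order_def)
    then show ?thesis by (simp add: matrix_vector_mult_def vec_power_nth)
  qed
  have "approx_order p
      (\<lambda>h. (\<Sum>j\<in>UNIV. \<alpha> $ i $ j *\<^sub>R G (y (tn h + (c $ j - 1) * h)))
         + (\<Sum>j\<in>UNIV. \<beta> $ i $ j *\<^sub>R G (y (tn h + c $ j * h))))
      (\<lambda>h. G (y (tn h + c $ i * h)))" for i
  proof -
    have eq: "(\<Sum>j\<in>UNIV. \<alpha> $ i $ j *\<^sub>R ?T (c $ j - 1) h) + (\<Sum>j\<in>UNIV. \<beta> $ i $ j *\<^sub>R ?T (c $ j) h)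
        = ?T (c $ i) h" for h
    proof -
      \<comment> \<open>A weighted sum of Taylor polynomials has the weighted moments of the nodes
        as coefficients.\<close>
      have sw: "(\<Sum>j\<in>UNIV. w j *\<^sub>R ?T (d j) h)
          = (\<Sum>k<p. ((\<Sum>j\<in>UNIV. w j * d j ^ k) / fact k * h ^ k) *\<^sub>R ?D k (tn h))" for w d :: "'a \<Rightarrow> real"
        by (simp only: scaleR_sum_right, subst sum.swap)
           (simp add: scaleR_sum_left sum_distrib_left sum_distrib_right sum_divide_distrib mult_ac)
      show ?thesis
        unfolding sw sum.distrib[symmetric] scaleR_add_left[symmetric]
        by (rule sum.cong) (simp_all add: row flip: add_divide_distrib distrib_right)
    qed
    have "approx_order p
      (\<lambda>h. (\<Sum>j\<in>UNIV. \<alpha> $ i $ j *\<^sub>R G (y (tn h + (c $ j - 1) * h)))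
         + (\<Sum>j\<in>UNIV. \<beta> $ i $ j *\<^sub>R G (y (tn h + c $ j * h))))
      (\<lambda>h. (\<Sum>j\<in>UNIV. \<alpha> $ i $ j *\<^sub>R ?T (c $ j - 1) h) + (\<Sum>j\<in>UNIV. \<beta> $ i $ j *\<^sub>R ?T (c $ j) h))"
      by (intro approx_order_add approx_order_sum approx_order_linear[OF bounded_linear_scaleR_right] T)
    then show ?thesis
      unfolding eq using approx_order_trans approx_order_sym[OF T] by blast
  qed
  then show ?thesis
    by (simp add: approx_order_vec_iff kron_I_nth blockwise_nth exact_stages_def)
qed

text \<open>Up to the factor \<open>fact k\<close>, \<open>w k\<close> is the coefficient of the
  \<open>k\<close>-th term: the part with \<open>M\<close> comes from the expansion of
  \<open>h\<close> times \<open>y'\<close> at the stages, the part with \<open>N\<close> from the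
  external data. It is used with \<open>w k = c ^ k\<close> for the stages and with the left side of
  the second order condition for the output.\<close>

lemma update_expansion:
  assumes "extrapolation_order p c \<alpha> \<beta>" "j \<le> p"
    and Z: "approx_order j Z (exact_stages c)"
    and Yold: "approx_order j Yold (exact_stages (c - 1))"
    and yold: "\<And>i. approx_order (Suc p) (\<lambda>h. yold h $ i) (\<lambda>h. external_exact p Q y h (tn h) i)"
    and w: "\<And>k. k \<le> j \<Longrightarrow> w k = real k *\<^sub>R (M *v c ^ (k - 1)) + fact k *\<^sub>R (N *v Q k)"
  shows "approx_order (Suc j) (\<lambda>h. imex_update M N \<alpha> \<beta> f g h (Yold h) (yold h) (Z h) $ i)
    (\<lambda>h. \<Sum>k\<le>j. (w k $ i / fact k * h ^ k) *\<^sub>R nth_derivative k y (tn h))"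
proof -
  let ?D = "\<lambda>k. nth_derivative k y"
  let ?E = "\<lambda>h. kron_I \<alpha> (blockwise f (Yold h)) + kron_I \<beta> (blockwise f (Z h)) + blockwise g (Z h)"
  have "approx_order j ?E (\<lambda>h. kron_I \<alpha> (blockwise f (exact_stages (c - 1) h))
      + kron_I \<beta> (blockwise f (exact_stages c h)) + blockwise g (exact_stages c h))"
    by (intro approx_order_add approx_order_linear[OF bounded_linear_kron_I] blockwise_approx
        smooth_f smooth_g Z Yold)
  also have "approx_order j \<dots> (\<lambda>h. blockwise f (exact_stages c h) + blockwise g (exact_stages c h))"
    by (intro approx_order_add approx_order_refl
        approx_order_mono[OF extrapolation_exact[OF assms(1) smooth_f] assms(2)])
  \<comment> \<open>Along the solution the sum of \<open>f\<close> and \<open>g\<close> is the first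
    derivative. The equation is given on \<open>J\<close> only, which contains the evaluation points
    for small \<open>h\<close>.\<close>
  also have "approx_order j \<dots> (\<lambda>h. \<chi> l. ?D 1 (tn h + c $ l * h))"
  proof -
    obtain d where d: "d > 0" "cball t0 d \<subseteq> J"
      using open_J t0_in_J open_contains_cball by blast
    have "approx_order j (\<lambda>h. f (y (tn h + a * h)) + g (y (tn h + a * h))) (\<lambda>h. ?D 1 (tn h + a * h))" for a
      using eventually_in_ball[OF d(1), of a]
    proof (intro approx_order_cong_ev, eventually_elim)
      case (elim h)
      then have "(y has_vector_derivative f (y (tn h + a * h)) + g (y (tn h + a * h))) (at (tn h + a * h))"
        using solution d(2) by (auto simp: ode_solution_on_def)
      then show ?case by (simp add: nth_derivative_def vector_derivative_at)
    qed
    then show ?thesis by (simp add: approx_order_vec_iff blockwise_nth exact_stages_def)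
  qed
  also have "approx_order j \<dots> (\<lambda>h. \<chi> l. \<Sum>k<j. (c $ l ^ k / fact k * h ^ k) *\<^sub>R ?D (Suc k) (tn h))"
    using taylor_solution[of j 1] by (simp add: approx_order_vec_iff)
  finally have E: "approx_order j (\<lambda>h. ?E h $ l)
      (\<lambda>h. \<Sum>k<j. (c $ l ^ k / fact k * h ^ k) *\<^sub>R ?D (Suc k) (tn h))" for l
    by (simp add: approx_order_vec_iff)
  have "approx_order j (\<lambda>h. kron_I M (?E h) $ i)
      (\<lambda>h. \<Sum>l\<in>UNIV. M $ i $ l *\<^sub>R (\<Sum>k<j. (c $ l ^ k / fact k * h ^ k) *\<^sub>R ?D (Suc k) (tn h)))"
    unfolding kron_I_nth
    by (intro approx_order_sum approx_order_linear[OF bounded_linear_scaleR_right] E)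
  from approx_order_power_scaleR[OF this, of 1]
  have 1: "approx_order (Suc j) (\<lambda>h. h *\<^sub>R kron_I M (?E h) $ i)
      (\<lambda>h. h *\<^sub>R (\<Sum>l\<in>UNIV. M $ i $ l *\<^sub>R (\<Sum>k<j. (c $ l ^ k / fact k * h ^ k) *\<^sub>R ?D (Suc k) (tn h))))"
    by simp
  \<comment> \<open>The external data are accurate to order \<open>Suc p\<close>; their terms with
    \<open>k > j\<close> are absorbed into the error.\<close>
  have "approx_order (Suc j) (\<lambda>h. yold h $ l) (\<lambda>h. \<Sum>k\<le>j. (Q k $ l * h ^ k) *\<^sub>R ?D k (tn h))" for l
    using approx_order_trans[OF approx_order_mono[OF yold[of l, unfolded external_exact_def], of "Suc j"]
        taylor_truncate[OF assms(2), of "\<lambda>k. Q k $ l"]] assms(2)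
    by simp
  then have 2: "approx_order (Suc j) (\<lambda>h. kron_I N (yold h) $ i)
      (\<lambda>h. \<Sum>l\<in>UNIV. N $ i $ l *\<^sub>R (\<Sum>k\<le>j. (Q k $ l * h ^ k) *\<^sub>R ?D k (tn h)))"
    unfolding kron_I_nth
    by (intro approx_order_sum approx_order_linear[OF bounded_linear_scaleR_right])
  have wi: "w k $ i / fact k = real k * (\<Sum>l\<in>UNIV. M $ i $ l * c $ l ^ (k - 1)) / fact k
      + (\<Sum>l\<in>UNIV. N $ i $ l * Q k $ l)" if "k \<le> j" for k
    by (simp add: w[OF that] matrix_vector_mult_def vec_power_nth add_divide_distrib)
  have "h *\<^sub>R (\<Sum>l\<in>UNIV. M $ i $ l *\<^sub>R (\<Sum>k<j. (c $ l ^ k / fact k * h ^ k) *\<^sub>R ?D (Suc k) (tn h)))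
      + (\<Sum>l\<in>UNIV. N $ i $ l *\<^sub>R (\<Sum>k\<le>j. (Q k $ l * h ^ k) *\<^sub>R ?D k (tn h)))
      = (\<Sum>k\<le>j. (w k $ i / fact k * h ^ k) *\<^sub>R ?D k (tn h))" for h
  proof -
    have "h *\<^sub>R (\<Sum>l\<in>UNIV. M $ i $ l *\<^sub>R (\<Sum>k<j. (c $ l ^ k / fact k * h ^ k) *\<^sub>R ?D (Suc k) (tn h)))
      = (\<Sum>k<j. ((\<Sum>l\<in>UNIV. M $ i $ l * c $ l ^ k) / fact k * h ^ Suc k) *\<^sub>R ?D (Suc k) (tn h))"
      by (simp only: scaleR_sum_right, subst sum.swap)
         (simp add: scaleR_sum_left sum_distrib_left sum_distrib_right sum_divide_distrib mult_ac)
    \<comment> \<open>Numerator and denominator are multiplied by \<open>Suc k\<close> to reach the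
      form of the order conditions.\<close>
    also have "\<dots> = (\<Sum>k<j. (real (Suc k) * (\<Sum>l\<in>UNIV. M $ i $ l * c $ l ^ (Suc k - 1)) / fact (Suc k)
        * h ^ Suc k) *\<^sub>R ?D (Suc k) (tn h))"
      by (simp del: of_nat_Suc)
    \<comment> \<open>The added term \<open>k = 0\<close> vanishes through its factor
      \<open>real k\<close>.\<close>
    also have "\<dots> = (\<Sum>k\<le>j. (real k * (\<Sum>l\<in>UNIV. M $ i $ l * c $ l ^ (k - 1)) / fact k
        * h ^ k) *\<^sub>R ?D k (tn h))"
      by (subst sum.atMost_shift) simp
    finally have a: "h *\<^sub>R (\<Sum>l\<in>UNIV. M $ i $ l *\<^sub>R (\<Sum>k<j. (c $ l ^ k / fact k * h ^ k) *\<^sub>R ?D (Suc k) (tn h))) = \<dots>" .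
    have b: "(\<Sum>l\<in>UNIV. N $ i $ l *\<^sub>R (\<Sum>k\<le>j. (Q k $ l * h ^ k) *\<^sub>R ?D k (tn h)))
      = (\<Sum>k\<le>j. ((\<Sum>l\<in>UNIV. N $ i $ l * Q k $ l) * h ^ k) *\<^sub>R ?D k (tn h))"
      by (simp only: scaleR_sum_right, subst sum.swap)
         (simp add: scaleR_sum_left sum_distrib_left sum_distrib_right mult_ac)
    show ?thesis
      unfolding a b sum.distrib[symmetric] scaleR_add_left[symmetric] distrib_right[symmetric]
      by (rule sum.cong) (simp_all add: wi)
  qed
  with approx_order_add[OF 1 2] show ?thesis
    by (simp add: imex_update_def)
qed

text \<open>Each derivative at \<open>tn h + h\<close> is expanded about \<open>tn h\<close>, and
  the terms are collected by total degree in \<open>h\<close>; this produces the sum in the second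
  order condition.\<close>

lemma external_exact_expansion:
  "approx_order (Suc p) (\<lambda>h. external_exact p Q y h (t0 + real (n + 1) * h) i)
    (\<lambda>h. \<Sum>k\<le>p. ((\<Sum>l\<le>k. (fact k / fact l) *\<^sub>R Q (k - l)) $ i / fact k * h ^ k)
       *\<^sub>R nth_derivative k y (tn h))"
proof -
  let ?D = "\<lambda>k. nth_derivative k y"
  \<comment> \<open>\<open>Suc p - k\<close> terms suffice, since the factor \<open>h ^ k\<close>
    supplies the remaining powers.\<close>
  let ?T = "\<lambda>k h. \<Sum>l<Suc p - k. (1 / fact l * h ^ l) *\<^sub>R ?D (k + l) (tn h)"
  have "approx_order (Suc p) (\<lambda>h. (Q k $ i * h ^ k) *\<^sub>R ?D k (tn h + h))
      (\<lambda>h. (Q k $ i * h ^ k) *\<^sub>R ?T k h)" if "k \<le> p" for k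
  proof -
    have "approx_order (Suc p - k) (\<lambda>h. Q k $ i *\<^sub>R ?D k (tn h + h)) (\<lambda>h. Q k $ i *\<^sub>R ?T k h)"
      using taylor_solution[of "Suc p - k" k 1]
      by (intro approx_order_linear[OF bounded_linear_scaleR_right]) simp
    from approx_order_power_scaleR[OF this, of k] that show ?thesis
      by (simp add: mult.commute)
  qed
  then have "approx_order (Suc p) (\<lambda>h. \<Sum>k\<le>p. (Q k $ i * h ^ k) *\<^sub>R ?D k (tn h + h))
      (\<lambda>h. \<Sum>k\<le>p. (Q k $ i * h ^ k) *\<^sub>R ?T k h)"
    by (intro approx_order_sum) auto
  moreover have "(\<Sum>k\<le>p. (Q k $ i * h ^ k) *\<^sub>R ?T k h)
      = (\<Sum>k\<le>p. ((\<Sum>l\<le>k. (fact k / fact l) *\<^sub>R Q (k - l)) $ i / fact k * h ^ k) *\<^sub>R ?D k (tn h))" for h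
  proof -
    let ?a = "\<lambda>l k. (Q k $ i / fact l * h ^ (k + l)) *\<^sub>R ?D (k + l) (tn h)"
    have "(\<Sum>k\<le>p. (Q k $ i * h ^ k) *\<^sub>R ?T k h) = (\<Sum>k\<le>p. \<Sum>l<Suc p - k. ?a l k)"
      by (simp add: scaleR_sum_right power_add mult_ac)
    also have "\<dots> = (\<Sum>(k, l)\<in>{(k, l). k + l \<le> p}. ?a l k)"
      by (subst sum.Sigma) (auto intro!: sum.cong)
    \<comment> \<open>The Taylor index is put first so that summation along diagonals yields
      \<open>Q (k - l)\<close> with the weight \<open>1 / fact l\<close>.\<close>
    also have "\<dots> = (\<Sum>(l, k)\<in>{(l, k). l + k \<le> p}. ?a l k)"
      by (rule sum.reindex_bij_witness[of _ prod.swap prod.swap]) auto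
    also have "\<dots> = (\<Sum>k\<le>p. \<Sum>l\<le>k. ?a l (k - l))"
      by (rule sum.triangle_reindex_eq)
    also have "\<dots> = (\<Sum>k\<le>p. ((\<Sum>l\<le>k. (fact k / fact l) *\<^sub>R Q (k - l)) $ i / fact k * h ^ k) *\<^sub>R ?D k (tn h))"
    proof (rule sum.cong[OF refl])
      fix k
      have "(\<Sum>l\<le>k. (fact k / fact l) *\<^sub>R Q (k - l)) $ i / fact k * h ^ k
          = (\<Sum>l\<le>k. Q (k - l) $ i / fact l * h ^ k)"
        by (simp add: sum_divide_distrib sum_distrib_right)
      then show "(\<Sum>l\<le>k. ?a l (k - l))
          = ((\<Sum>l\<le>k. (fact k / fact l) *\<^sub>R Q (k - l)) $ i / fact k * h ^ k) *\<^sub>R ?D k (tn h)"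
        by (simp add: scaleR_sum_left)
    qed
    finally show ?thesis .
  qed
  moreover have "t0 + real (n + 1) * h = tn h + h" for h by (simp add: algebra_simps)
  ultimately show ?thesis by (simp only: external_exact_def)
qed

text \<open>Each pass through the stage equations gains one power of \<open>h\<close>, because every occurrence of
  the stages on the right-hand side carries a factor \<open>h\<close>.\<close>

lemma stage_error:
  assumes "extrapolation_order p c \<alpha> \<beta>" "q \<le> p"
    and stage: "\<And>k. k \<le> q \<Longrightarrow> c ^ k = real k *\<^sub>R (A *v c ^ (k - 1)) + fact k *\<^sub>R (U *v Q k)"
    and Yold: "approx_order (Suc q) Yold (exact_stages (c - 1))"
    and yold: "\<And>i. approx_order (Suc p) (\<lambda>h. yold h $ i) (\<lambda>h. external_exact p Q y h (tn h) i)"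
    and Ynew: "bounded_stage_solution A U \<alpha> \<beta> f g Yold yold Ynew"
    and "j \<le> Suc q"
  shows "approx_order j Ynew (exact_stages c)"
  using assms(7)
proof (induction j)
  case 0
  \<comment> \<open>Two bounded families agree to order 0; the boundedness of the stage solution
    starts the induction here.\<close>
  have "approx_order 0 Ynew (\<lambda>_. 0)"
    using Ynew by (simp add: bounded_stage_solution_def approx_order_iff)
  then show ?case using approx_order_trans approx_order_sym[OF exact_stages_bounded] by blast
next
  case (Suc j)
  have IH: "approx_order j Ynew (exact_stages c)" using Suc by simp
  have j: "j \<le> q" "j \<le> p" using Suc.prems assms(2) by simp_all
  have "approx_order (Suc j) (\<lambda>h. Ynew h $ i) (\<lambda>h. exact_stages c h $ i)" for i
  proof -
    have "\<forall>\<^sub>F h in at_right 0. Ynew h = imex_update A U \<alpha> \<beta> f g h (Yold h) (yold h) (Ynew h)"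
      using Ynew by (simp add: bounded_stage_solution_def imex_stages_iff_update)
    then have "approx_order (Suc j) (\<lambda>h. Ynew h $ i)
        (\<lambda>h. imex_update A U \<alpha> \<beta> f g h (Yold h) (yold h) (Ynew h) $ i)"
      by (intro approx_order_cong_ev) (erule eventually_mono, rule arg_cong)
    \<comment> \<open>The stage conditions for \<open>k \<le> j \<le> q\<close> make the
      coefficients equal to those of the Taylor polynomial of the exact stages.\<close>
    also have "approx_order (Suc j) \<dots> (\<lambda>h. \<Sum>k\<le>j. ((c ^ k) $ i / fact k * h ^ k) *\<^sub>R nth_derivative k y (tn h))"
      using j by (intro update_expansion[OF assms(1) _ IH _ yold] approx_order_mono[OF Yold] stage) auto
    also have "approx_order (Suc j) \<dots> (\<lambda>h. exact_stages c h $ i)"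
      using approx_order_sym[OF taylor_solution[of "Suc j" 0 "c $ i"]]
      by (simp add: exact_stages_def nth_derivative_0 vec_power_nth lessThan_Suc_atMost del: sum.lessThan_Suc)
    finally show ?thesis .
  qed
  then show ?case by (subst approx_order_vec_iff) blast
qed

end

section \<open>From the expansions to the order of the IMEX step\<close>

theorem theorem3p1:
  fixes p q :: nat
    and c :: "real ^ 's :: {finite, linorder}"
    and A \<alpha> \<beta> :: "real ^ 's :: {finite, linorder} ^ 's :: {finite, linorder}"
    and U :: "real ^ 'r ^ 's :: {finite, linorder}"
    and B :: "real ^ 's :: {finite, linorder} ^ 'r"
    and V :: "real ^ 'r ^ 'r"
  assumes "p \<ge> 1"
    and "q = p \<or> q = p - 1"
    and "lower_triangular A"
    and "glm_order p q c A U B V"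
    and "strictly_lower_triangular \<beta>"
    and "extrapolation_order p c \<alpha> \<beta>"
  shows "imex_glm_order TYPE('m :: finite) p q c A U B V \<alpha> \<beta>"
proof -
  \<comment> \<open>By \<open>p \<le> Suc q\<close> the stage errors are \<open>O(h^p)\<close>, and
    the factor \<open>h\<close> in the output formula makes them \<open>O(h^(p+1))\<close>.\<close>
  have q: "q \<le> p" "p \<le> Suc q" using assms(2) by auto
  obtain Q where
    stage: "\<And>k. k \<le> q \<Longrightarrow> c ^ k = real k *\<^sub>R (A *v c ^ (k - 1)) + fact k *\<^sub>R (U *v Q k)" and
    out: "\<And>k. k \<le> p \<Longrightarrow> (\<Sum>l\<le>k. (fact k / fact l) *\<^sub>R Q (k - l))
      = real k *\<^sub>R (B *v c ^ (k - 1)) + fact k *\<^sub>R (V *v Q k)"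
    using assms(4) unfolding glm_order_def diff_diff_eq right_minus_eq by blast
  show ?thesis
    unfolding imex_glm_order_def
  \<comment> \<open>The vectors of the underlying method serve unchanged for the IMEX
    method.\<close>
  proof (rule exI[of _ Q], intro allI impI, elim conjE)
    fix f g :: "real ^ 'm \<Rightarrow> real ^ 'm" and J :: "real set" and y t0 and n :: nat and Yold yold
    assume step: "smooth f" "smooth g" "open J" "t0 \<in> J" "ode_solution_on J (\<lambda>x. f x + g x) y"
      and Yold: "\<forall>i. approx_order (q + 1) (\<lambda>h. Yold h $ i) (\<lambda>h. y (t0 + real n * h + (c $ i - 1) * h))"
      and yold: "\<forall>i. approx_order (p + 1) (\<lambda>h. yold h $ i) (\<lambda>h. external_exact p Q y h (t0 + real n * h) i)"
    interpret ode_step f g J y t0 n by unfold_locales (fact step)+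
    have Yold': "approx_order (Suc q) Yold (exact_stages (c - 1))"
      using Yold by (simp add: approx_order_vec_iff exact_stages_def)
    have yold': "approx_order (Suc p) (\<lambda>h. yold h $ i) (\<lambda>h. external_exact p Q y h (tn h) i)" for i
      using yold by simp
    \<comment> \<open>The existence argument needs bounded inputs; each term of the exact external
      values is \<open>O(h^k)\<close> and hence bounded.\<close>
    have "approx_order 0 (\<lambda>h. external_exact p Q y h (tn h) i) (\<lambda>_. \<Sum>k\<le>p. 0)" for i
      unfolding external_exact_def by (intro approx_order_sum approx_order_mono[OF taylor_term]) simp
    then have "approx_order 0 yold (\<lambda>_. 0)"
      using approx_order_trans[OF approx_order_mono[OF yold']] by (subst approx_order_vec_iff) simp
    moreover have "approx_order 0 Yold (\<lambda>_. 0)"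
      using approx_order_trans[OF approx_order_mono[OF Yold'] exact_stages_bounded] by simp
    ultimately have ex: "\<exists>Ynew. bounded_stage_solution A U \<alpha> \<beta> f g Yold yold Ynew"
      by (intro bounded_stage_solution_exists smooth_continuous_on step)
    have "(\<forall>i. approx_order (q + 1) (\<lambda>h. Ynew h $ i) (\<lambda>h. y (t0 + real n * h + c $ i * h))) \<and>
        (\<forall>i. approx_order (p + 1)
               (\<lambda>h. imex_output B V \<alpha> \<beta> f g h (Yold h) (yold h) (Ynew h) $ i)
               (\<lambda>h. external_exact p Q y h (t0 + real (n + 1) * h) i))"
      if "bounded_stage_solution A U \<alpha> \<beta> f g Yold yold Ynew" for Ynew
    proof (intro conjI allI)
      have err: "approx_order j Ynew (exact_stages c)" if "j \<le> Suc q" for j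
        by (rule stage_error[OF assms(6) q(1) stage Yold' yold' \<open>bounded_stage_solution A U \<alpha> \<beta> f g Yold yold Ynew\<close> that])
      show "approx_order (q + 1) (\<lambda>h. Ynew h $ i) (\<lambda>h. y (t0 + real n * h + c $ i * h))" for i
        using err[of "Suc q"] by (simp add: approx_order_vec_iff exact_stages_def)
      show "approx_order (p + 1) (\<lambda>h. imex_output B V \<alpha> \<beta> f g h (Yold h) (yold h) (Ynew h) $ i)
               (\<lambda>h. external_exact p Q y h (t0 + real (n + 1) * h) i)" for i
      proof -
        \<comment> \<open>With \<open>j = p\<close>, the conditions \<open>out\<close> turn the
          coefficients of the update into those of the exact external values at the next time
          point.\<close>
        have "approx_order (Suc p) (\<lambda>h. imex_update B V \<alpha> \<beta> f g h (Yold h) (yold h) (Ynew h) $ i)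
            (\<lambda>h. \<Sum>k\<le>p. ((\<Sum>l\<le>k. (fact k / fact l) *\<^sub>R Q (k - l)) $ i / fact k * h ^ k)
              *\<^sub>R nth_derivative k y (tn h))"
          by (rule update_expansion[OF assms(6) order_refl err[OF q(2)] approx_order_mono[OF Yold' q(2)] yold' out])
        then show ?thesis
          using approx_order_trans approx_order_sym[OF external_exact_expansion]
          unfolding imex_output_eq_update Suc_eq_plus1 by blast
      qed
    qed
    with ex show "(\<exists>Ynew. bounded_stage_solution A U \<alpha> \<beta> f g Yold yold Ynew) \<and>
      (\<forall>Ynew. bounded_stage_solution A U \<alpha> \<beta> f g Yold yold Ynew \<longrightarrow>
        (\<forall>i. approx_order (q + 1) (\<lambda>h. Ynew h $ i) (\<lambda>h. y (t0 + real n * h + c $ i * h))) \<and>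
        (\<forall>i. approx_order (p + 1)
               (\<lambda>h. imex_output B V \<alpha> \<beta> f g h (Yold h) (yold h) (Ynew h) $ i)
               (\<lambda>h. external_exact p Q y h (t0 + real (n + 1) * h) i)))"
      by blast
  qed
qed

end
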